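(* There is a deterministic algorithm for the Search on Trees problem which, when given a tree $T=(V,E)$ of pathwidth $k$ and a prediction $s\in V$, finds the unknown target $t\in V$ using at most $O(k\log \mathrm{dist}(s,t))$ queries.
   Context: Search on Trees problem: we are given a finite tree $T=(V,E)$ and a prediction $s\in V$; there is an unknown target node $t\in V$. The algorithm may adaptively query any node $x\in V$; the query returns "here" if $x=t$, and otherwise returns the unique neighbor of $x$ lying on the path in $T$ from $x$ to $t$. The goal is to find $t$. $\mathrm{dist}(s,t)$ is the number of edges on the path in $T$ between $s$ and $t$. Pathwidth: a path decomposition of a graph $G$ is a sequence of vertex sets $B_1,\dots,B_m$ whose union is $V(G)$, such that every edge has both endpoints in some $B_i$, and for every vertex $v$ the set $\{i: v\in B_i\}$ is an interval; its width is $\max_i|B_i|-1$, and the pathwidth of $G$ is the minimum width of a path decomposition. *)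

theory Defs
  imports Complex_Main "Graph_Theory.Graph_Theory"
begin

text \<open>
  A finite simple graph is a symmetric, loop-free, finite pair digraph (\<open>pair_graph\<close>), each edge
  being represented by its two opposite arcs. The constant \<open>tree\<close> of the graph library is not
  suitable here: for it, the two arcs of a single edge already form a cycle. A cycle of the
  underlying simple graph is a library cycle of length at least three.
\<close>

definition simple_tree :: "'v pair_pre_digraph \<Rightarrow> bool" where
  "simple_tree T \<longleftrightarrow>
     pair_graph T \<and> Digraph_Component.connected (with_proj T) \<and>
     \<not> (\<exists>c. pre_digraph.cycle (with_proj T) c \<and> 3 \<le> length c)"

definition tree_path :: "'v pair_pre_digraph \<Rightarrow> 'v \<Rightarrow> 'v \<Rightarrow> ('v \<times> 'v) awalk" where
  "tree_path T u v = (THE p. pre_digraph.apath (with_proj T) u p v)"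

definition tree_dist :: "'v pair_pre_digraph \<Rightarrow> 'v \<Rightarrow> 'v \<Rightarrow> nat" where
  "tree_dist T u v = length (tree_path T u v)"

definition path_decomposition :: "'v pair_pre_digraph \<Rightarrow> 'v set list \<Rightarrow> bool" where
  "path_decomposition G Bs \<longleftrightarrow>
     \<Union> (set Bs) = pverts G \<and>
     (\<forall>(u, v) \<in> parcs G. \<exists>B \<in> set Bs. u \<in> B \<and> v \<in> B) \<and>
     (\<forall>v \<in> pverts G. \<forall>i j l. i \<le> j \<and> j \<le> l \<and> l < length Bs \<and> v \<in> Bs ! i \<and> v \<in> Bs ! l
        \<longrightarrow> v \<in> Bs ! j)"

definition decomposition_width :: "'v set list \<Rightarrow> nat" where
  "decomposition_width Bs = Max (card ` set Bs) - 1"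

definition pathwidth :: "'v pair_pre_digraph \<Rightarrow> nat" where
  "pathwidth G = (LEAST w. \<exists>Bs. path_decomposition G Bs \<and> decomposition_width Bs = w)"

datatype 'v reply = Here | Toward 'v

definition query_reply :: "'v pair_pre_digraph \<Rightarrow> 'v \<Rightarrow> 'v \<Rightarrow> 'v reply" where
  "query_reply T t x =
     (if x = t then Here
      else Toward (THE y. (x, y) \<in> parcs T \<and>
                          y \<in> set (pre_digraph.awalk_verts (with_proj T) x (tree_path T x t))))"

text \<open>
  A deterministic adaptive strategy is a decision tree: it either stops and announces a node as the
  target, or queries a node and continues depending on the reply. A strategy is run against the
  function that yields the reply to each query.
\<close>

datatype 'v strategy = Announce 'v | Query 'v "'v reply \<Rightarrow> 'v strategy"

primrec announced :: "'v strategy \<Rightarrow> ('v \<Rightarrow> 'v reply) \<Rightarrow> 'v" where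
  "announced (Announce v) r = v"
| "announced (Query x next) r = announced (next (r x)) r"

primrec queries :: "'v strategy \<Rightarrow> ('v \<Rightarrow> 'v reply) \<Rightarrow> 'v list" where
  "queries (Announce v) r = []"
| "queries (Query x next) r = x # queries (next (r x)) r"

text \<open>
  An algorithm sees only the tree and the prediction; the target enters solely through the replies.
\<close>

definition solves_tree_search :: "('v pair_pre_digraph \<Rightarrow> 'v \<Rightarrow> 'v strategy) \<Rightarrow> bool" where
  "solves_tree_search alg \<longleftrightarrow>
     (\<forall>T. simple_tree T \<longrightarrow>
       (\<forall>s \<in> pverts T. \<forall>t \<in> pverts T.
          set (queries (alg T s) (query_reply T t)) \<subseteq> pverts T \<and>
          announced (alg T s) (query_reply T t) = t))"

end

theory Submission
  imports Defs
begin

text \<open>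
  Induction on the width \<open>k\<close> of a fixed path decomposition restricted to a subtree \<open>S\<close>. The tree path
  from a vertex in the first bag meeting \<open>S\<close> to a vertex in the last one meets every bag in between,
  so the branches hanging off this path have width at most \<open>k - 1\<close>. Let \<open>p\<close> be the vertex of the path
  closest to the prediction \<open>s\<close> and query it. If the target lies in the same branch as \<open>s\<close>, recurse
  there with the prediction \<open>s\<close>. Otherwise \<open>p\<close> lies between \<open>s\<close> and the target; a galloping search along
  the path, starting at \<open>p\<close>, finds the branch of the target with \<open>O(log dist(s,t))\<close> queries, and
  the recursion continues from the root of that branch, which is no farther from the target than \<open>s\<close>.
\<close>

section \<open>Strategies with a target-dependent budget\<close>

text \<open>The strategy is chosen before the target, so it must serve every member of
  \<open>A\<close>, which stands for the targets still consistent with the replies so far. The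
  budget varies with the target because the final bound does.\<close>

definition solvable :: "'v set \<Rightarrow> ('v \<Rightarrow> 'v \<Rightarrow> 'v reply) \<Rightarrow> 'v set \<Rightarrow> ('v \<Rightarrow> real) \<Rightarrow> bool" where
  "solvable V r A f \<longleftrightarrow> (\<exists>\<sigma>. \<forall>t\<in>A. set (queries \<sigma> (r t)) \<subseteq> V \<and> announced \<sigma> (r t) = t \<and>
     real (length (queries \<sigma> (r t))) \<le> f t)"

lemma solvable_mono:
  assumes "solvable V r A f" "B \<subseteq> A" "\<And>t. t \<in> B \<Longrightarrow> f t \<le> g t"
  shows "solvable V r B g"
proof -
  obtain \<sigma> where \<sigma>: "\<forall>t\<in>A. set (queries \<sigma> (r t)) \<subseteq> V \<and> announced \<sigma> (r t) = t \<and>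
     real (length (queries \<sigma> (r t))) \<le> f t"
    using assms(1) unfolding solvable_def by blast
  have "set (queries \<sigma> (r t)) \<subseteq> V \<and> announced \<sigma> (r t) = t \<and>
     real (length (queries \<sigma> (r t))) \<le> g t" if "t \<in> B" for t
    using bspec[OF \<sigma>, of t] assms(2,3) that by force
  then show ?thesis unfolding solvable_def by blast
qed

lemma solvable_empty: "solvable V r {} f"
  unfolding solvable_def by simp

lemma solvable_singleton:
  assumes "A \<subseteq> {v}" "\<And>t. t \<in> A \<Longrightarrow> 0 \<le> f t"
  shows "solvable V r A f"
  unfolding solvable_def using assms by (intro exI[of _ "Announce v"]) auto

text \<open>Each reply gets its own continuation, which has to serve only the targets that give this
  reply.\<close>

lemma solvable_query:
  assumes "x \<in> V" and sub: "\<And>\<rho>. solvable V r {t \<in> A. r t x = \<rho>} f"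
  shows "solvable V r A (\<lambda>t. f t + 1)"
proof -
  obtain nx where nx: "\<And>\<rho>. \<forall>t\<in>{t \<in> A. r t x = \<rho>}. set (queries (nx \<rho>) (r t)) \<subseteq> V \<and>
      announced (nx \<rho>) (r t) = t \<and> real (length (queries (nx \<rho>) (r t))) \<le> f t"
    using sub unfolding solvable_def by metis
  have "set (queries (Query x nx) (r t)) \<subseteq> V \<and> announced (Query x nx) (r t) = t \<and>
      real (length (queries (Query x nx) (r t))) \<le> f t + 1" if "t \<in> A" for t
    using bspec[OF nx, of t "r t x"] that assms(1) by simp
  then show ?thesis unfolding solvable_def by blast
qed

section \<open>Searching along a line\<close>

text \<open>
  The reply to a query at \<open>x i\<close> reveals how the position \<open>\<pi> t\<close> of the target compares with \<open>i\<close>;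
  once the position is known, the budget \<open>f\<close> suffices.
\<close>

locale line_search =
  fixes V :: "'v set" and r :: "'v \<Rightarrow> 'v \<Rightarrow> 'v reply" and A :: "'v set"
    and x :: "nat \<Rightarrow> 'v" and m :: nat and \<pi> :: "'v \<Rightarrow> nat" and f :: "'v \<Rightarrow> real"
  assumes x_in: "\<And>i. i \<le> m \<Longrightarrow> x i \<in> V"
    and pos_le: "\<And>t. t \<in> A \<Longrightarrow> \<pi> t \<le> m"
    and compare: "\<And>i t t'. i \<le> m \<Longrightarrow> t \<in> A \<Longrightarrow> t' \<in> A \<Longrightarrow> r t (x i) = r t' (x i) \<Longrightarrow>
        (\<pi> t < i \<longleftrightarrow> \<pi> t' < i) \<and> (i < \<pi> t \<longleftrightarrow> i < \<pi> t')"
    and level: "\<And>i. i \<le> m \<Longrightarrow> solvable V r {t \<in> A. \<pi> t = i} f"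
begin

text \<open>By \<open>compare\<close>, targets with the same reply at \<open>x i\<close> lie on the
  same side of \<open>i\<close>, so each reply class falls inside one of the three sets.\<close>

lemma solvable_split:
  assumes "i \<le> m" "B \<subseteq> A"
    and less: "solvable V r {t \<in> B. \<pi> t < i} g"
    and eq: "solvable V r {t \<in> B. \<pi> t = i} g"
    and greater: "solvable V r {t \<in> B. i < \<pi> t} g"
  shows "solvable V r B (\<lambda>t. g t + 1)"
proof (rule solvable_query[OF x_in[OF \<open>i \<le> m\<close>]])
  fix \<rho>
  let ?B = "{t \<in> B. r t (x i) = \<rho>}"
  have "?B \<subseteq> {t \<in> B. \<pi> t < i} \<or> ?B \<subseteq> {t \<in> B. \<pi> t = i} \<or> ?B \<subseteq> {t \<in> B. i < \<pi> t}"
  proof (cases "?B = {}")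
    case False
    then obtain t where t: "t \<in> B" "r t (x i) = \<rho>" by blast
    have same: "(\<pi> t' < i \<longleftrightarrow> \<pi> t < i) \<and> (i < \<pi> t' \<longleftrightarrow> i < \<pi> t) \<and> (\<pi> t' = i \<longleftrightarrow> \<pi> t = i)"
      if "t' \<in> ?B" for t'
    proof -
      have "(\<pi> t' < i \<longleftrightarrow> \<pi> t < i) \<and> (i < \<pi> t' \<longleftrightarrow> i < \<pi> t)"
        using compare[OF \<open>i \<le> m\<close>, of t' t] that t \<open>B \<subseteq> A\<close> by auto
      then show ?thesis by (metis nat_neq_iff)
    qed
    consider "\<pi> t < i" | "\<pi> t = i" | "i < \<pi> t" by linarith
    then show ?thesis by cases (use same in auto)
  qed blast
  then show "solvable V r ?B g"
    using solvable_mono[OF less _ order_refl] solvable_mono[OF eq _ order_refl]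
      solvable_mono[OF greater _ order_refl] by blast
qed

text \<open>One query at \<open>l + 2 ^ n\<close> halves a window of \<open>2 ^ Suc n\<close>
  positions.\<close>

lemma binary_search:
  "solvable V r {t \<in> A. l \<le> \<pi> t \<and> \<pi> t < l + 2 ^ n} (\<lambda>t. f t + real n)"
proof (induction n arbitrary: l)
  case 0
  show ?case
  proof (cases "l \<le> m")
    case True
    show ?thesis by (rule solvable_mono[OF level[OF True]]) auto
  next
    case False
    then have e: "{t \<in> A. l \<le> \<pi> t \<and> \<pi> t < l + 2 ^ 0} = {}" using pos_le by fastforce
    show ?thesis unfolding e by (rule solvable_empty)
  qed
next
  case (Suc n)
  let ?B = "{t \<in> A. l \<le> \<pi> t \<and> \<pi> t < l + 2 ^ Suc n}"
  show ?case
  proof (cases "l + 2 ^ n \<le> m")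
    case True
    have "solvable V r ?B (\<lambda>t. (f t + real n) + 1)"
    proof (rule solvable_split[OF True])
      show "solvable V r {t \<in> ?B. \<pi> t < l + 2 ^ n} (\<lambda>t. f t + real n)"
        by (rule solvable_mono[OF Suc.IH[of l]]) auto
      show "solvable V r {t \<in> ?B. \<pi> t = l + 2 ^ n} (\<lambda>t. f t + real n)"
        by (rule solvable_mono[OF level[OF True]]) auto
      show "solvable V r {t \<in> ?B. l + 2 ^ n < \<pi> t} (\<lambda>t. f t + real n)"
        by (rule solvable_mono[OF Suc.IH[of "l + 2 ^ n"]]) auto
    qed auto
    then show ?thesis by (rule solvable_mono) auto
  next
    \<comment> \<open>The upper half lies beyond \<open>m\<close> and holds no target, so no query
      is spent.\<close>
    case False
    then show ?thesis
      by (intro solvable_mono[OF Suc.IH[of l]]) (auto dest: pos_le)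
  qed
qed

text \<open>If \<open>i\<close> is the largest exponent with \<open>a + 2 ^ i \<le> \<pi> t\<close>,
  doubling takes at most \<open>i - j + 1\<close> queries and the binary search in the last window
  \<open>i\<close> more; \<open>i\<close> is at most the logarithm of
  \<open>\<pi> t - a\<close>.\<close>

lemma galloping_search:
  "solvable V r {t \<in> A. a + 2 ^ j \<le> \<pi> t} (\<lambda>t. f t + (2 * log 2 (real (\<pi> t - a)) + 1 - real j))"
proof (induction "m - j" arbitrary: j rule: less_induct)
  case less
  let ?g = "\<lambda>t. f t + (2 * log 2 (real (\<pi> t - a)) + 1 - real j)"
  let ?B = "{t \<in> A. a + 2 ^ j \<le> \<pi> t}"
  have log_ge: "real j \<le> log 2 (real (\<pi> t - a))" if "a + 2 ^ j \<le> \<pi> t" for t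
  proof -
    have le: "(2::nat) ^ j \<le> \<pi> t - a" using that by simp
    have "(2::real) ^ j \<le> real (\<pi> t - a)" using of_nat_mono[OF le, where ?'a = real] by simp
    moreover have "0 < \<pi> t - a" using le by (meson less_le_trans pos2 zero_less_power)
    ultimately show ?thesis by (simp add: le_log_iff powr_realpow)
  qed
  have near: "solvable V r {t \<in> A. a + 2 ^ j \<le> \<pi> t \<and> \<pi> t < a + 2 ^ Suc j} (\<lambda>t. ?g t - 1)"
    proof (rule solvable_mono[OF binary_search[of "a + 2 ^ j" j]])
    fix t assume "t \<in> {t \<in> A. a + 2 ^ j \<le> \<pi> t \<and> \<pi> t < a + 2 ^ Suc j}"
    then show "f t + real j \<le> ?g t - 1" using log_ge[of t] by (simp del: of_nat_diff)
  qed auto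
  show ?case
  proof (cases "a + 2 ^ Suc j \<le> m")
    case True
    \<comment> \<open>With \<open>2 ^ Suc j\<close> at most \<open>m\<close>, this keeps
      \<open>j\<close> below \<open>m\<close>, so the truncated difference \<open>m - j\<close>
      really decreases.\<close>
    have "Suc j < 2 ^ Suc j" by (rule less_exp)
    with True have "m - Suc j < m - j" by linarith
    then have far: "solvable V r {t \<in> A. a + 2 ^ Suc j \<le> \<pi> t} (\<lambda>t. ?g t - 1)"
      by (intro solvable_mono[OF less.hyps[of "Suc j"]]) auto
    have "solvable V r ?B (\<lambda>t. (?g t - 1) + 1)"
    proof (rule solvable_split[OF True])
      show "solvable V r {t \<in> ?B. \<pi> t < a + 2 ^ Suc j} (\<lambda>t. ?g t - 1)"
        by (rule solvable_mono[OF near]) auto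
      show "solvable V r {t \<in> ?B. \<pi> t = a + 2 ^ Suc j} (\<lambda>t. ?g t - 1)"
        by (rule solvable_mono[OF far]) auto
      show "solvable V r {t \<in> ?B. a + 2 ^ Suc j < \<pi> t} (\<lambda>t. ?g t - 1)"
        by (rule solvable_mono[OF far]) auto
    qed auto
    then show ?thesis by (rule solvable_mono) auto
  next
    case False
    then show ?thesis by (intro solvable_mono[OF near]) (auto dest: pos_le)
  qed
qed

lemma search_right:
  "solvable V r {t \<in> A. a < \<pi> t} (\<lambda>t. f t + (2 * log 2 (real (\<pi> t - a)) + 1))"
  by (rule solvable_mono[OF galloping_search[of a 0]]) auto

end

text \<open>Reflecting the line turns a search to the left into one to the right;
  \<open>pos_le\<close> keeps the truncated subtraction exact.\<close>

lemma (in line_search) reversed: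
  "line_search V r A (\<lambda>i. x (m - i)) m (\<lambda>t. m - \<pi> t) f"
proof
  fix i t t'
  assume "i \<le> m" "t \<in> A" "t' \<in> A" "r t (x (m - i)) = r t' (x (m - i))"
  then show "(m - \<pi> t < i \<longleftrightarrow> m - \<pi> t' < i) \<and> (i < m - \<pi> t \<longleftrightarrow> i < m - \<pi> t')"
    using compare[of "m - i" t t'] pos_le[of t] pos_le[of t'] by linarith
next
  fix i assume "i \<le> m"
  show "solvable V r {t \<in> A. m - \<pi> t = i} f"
    by (rule solvable_mono[OF level[of "m - i"]]) (use \<open>i \<le> m\<close> pos_le in fastforce)+
qed (auto intro: x_in)

lemma (in line_search) search_from:
  assumes "a \<le> m"
  shows "solvable V r A (\<lambda>t. f t + (2 * log 2 (\<bar>real (\<pi> t) - real a\<bar> + 1) + 2))"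
proof -
  interpret rev: line_search V r A "\<lambda>i. x (m - i)" m "\<lambda>t. m - \<pi> t" f by (rule reversed)
  \<comment> \<open>The query at \<open>a\<close> that chooses the direction is the unit still
    missing here. The 1 inside the logarithm makes it vanish at \<open>\<pi> t = a\<close>.\<close>
  let ?g = "\<lambda>t. f t + (2 * log 2 (\<bar>real (\<pi> t) - real a\<bar> + 1) + 1)"
  have "solvable V r A (\<lambda>t. ?g t + 1)"
  proof (rule solvable_split[OF assms order_refl])
    show "solvable V r {t \<in> A. \<pi> t = a} ?g"
      by (rule solvable_mono[OF level[OF assms]]) auto
    show "solvable V r {t \<in> A. a < \<pi> t} ?g"
      by (rule solvable_mono[OF search_right[of a]]) (auto simp: of_nat_diff)
    show "solvable V r {t \<in> A. \<pi> t < a} ?g"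
    proof (rule solvable_mono[OF rev.search_right[of "m - a"]])
      fix t assume t: "t \<in> {t \<in> A. \<pi> t < a}"
      then have "real (m - \<pi> t - (m - a)) = real a - real (\<pi> t)" using assms by simp
      with t show "f t + (2 * log 2 (real (m - \<pi> t - (m - a))) + 1) \<le> ?g t" by simp
    qed (use assms in auto)
  qed
  then show ?thesis by (rule solvable_mono) auto
qed

section \<open>Trees seen through query replies\<close>

text \<open>
  \<open>nxt x t\<close> is the neighbour of \<open>x\<close> on the path to \<open>t\<close>; it carries no information for \<open>x = t\<close>.
\<close>

locale tree_navigation =
  fixes V :: "'v set" and E :: "('v \<times> 'v) set" and nxt :: "'v \<Rightarrow> 'v \<Rightarrow> 'v"
    and dist :: "'v \<Rightarrow> 'v \<Rightarrow> nat"
  assumes finite_V: "finite V"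
    and E_subset: "E \<subseteq> V \<times> V"
    and nxt_edge: "\<And>x t. x \<in> V \<Longrightarrow> t \<in> V \<Longrightarrow> x \<noteq> t \<Longrightarrow> (x, nxt x t) \<in> E"
    and dist_nxt: "\<And>x t. x \<in> V \<Longrightarrow> t \<in> V \<Longrightarrow> x \<noteq> t \<Longrightarrow> dist x t = Suc (dist (nxt x t) t)"
    and dist_self: "\<And>x. x \<in> V \<Longrightarrow> dist x x = 0"
    and edge_orientation: "\<And>x y t. (x, y) \<in> E \<Longrightarrow> t \<in> V \<Longrightarrow>
        (x \<noteq> t \<and> nxt x t = y) \<longleftrightarrow> \<not> (y \<noteq> t \<and> nxt y t = x)"
    and nxt_eq_if_edge: "\<And>u v x. (u, v) \<in> E \<Longrightarrow> x \<in> V \<Longrightarrow> u \<noteq> x \<Longrightarrow> v \<noteq> x \<Longrightarrow> nxt x u = nxt x v"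
begin

definition reply :: "'v \<Rightarrow> 'v \<Rightarrow> 'v reply" where
  "reply t x = (if x = t then Here else Toward (nxt x t))"

text \<open>Closure under \<open>nxt\<close> keeps the path between any two members inside
  \<open>S\<close>: these are the connected vertex sets, together with the empty set.\<close>

definition subtree :: "'v set \<Rightarrow> bool" where
  "subtree S \<longleftrightarrow> S \<subseteq> V \<and> (\<forall>x\<in>S. \<forall>t\<in>S. x \<noteq> t \<longrightarrow> nxt x t \<in> S)"

text \<open>For \<open>x\<close> in a subtree \<open>S\<close>, the nonempty branches are the
  components of \<open>S\<close> without \<open>x\<close>.\<close>

definition branch :: "'v set \<Rightarrow> 'v \<Rightarrow> 'v \<Rightarrow> 'v set" where
  "branch S x q = {t \<in> S. x \<noteq> t \<and> nxt x t = q}"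

lemma nxt_in: "x \<in> V \<Longrightarrow> t \<in> V \<Longrightarrow> x \<noteq> t \<Longrightarrow> nxt x t \<in> V"
  using nxt_edge E_subset by blast

lemma edge_neq: "(x, y) \<in> E \<Longrightarrow> x \<noteq> y"
  using edge_orientation E_subset by blast

lemma nxt_of_edge: "(x, y) \<in> E \<Longrightarrow> nxt x y = y"
  using edge_orientation[of x y y] E_subset by blast

lemma dist_eq_0D: "x \<in> V \<Longrightarrow> t \<in> V \<Longrightarrow> dist x t = 0 \<Longrightarrow> x = t"
  using dist_nxt by fastforce

text \<open>Since \<open>nxt x\<close> is constant along edges avoiding \<open>x\<close>, a path
  could leave the branch only through \<open>x\<close>. If the step from \<open>u\<close> towards
  \<open>v\<close> hit \<open>x\<close>, the orientation of the edge \<open>(u, x)\<close> would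
  give \<open>u\<close> and \<open>v\<close> different first steps from \<open>x\<close>.\<close>

lemma subtree_branch:
  assumes S: "subtree S" and x: "x \<in> V"
  shows "subtree (branch S x q)"
proof -
  have "nxt u v \<in> branch S x q"
    if u: "u \<in> branch S x q" and v: "v \<in> branch S x q" and uv: "u \<noteq> v" for u v
  proof -
    have uvS: "u \<in> S" "v \<in> S" "x \<noteq> u" "nxt x u = q" "x \<noteq> v" "nxt x v = q"
      using u v by (auto simp: branch_def)
    then have e: "(u, nxt u v) \<in> E" and S': "nxt u v \<in> S"
      using S uv nxt_edge by (auto simp: subtree_def)
    have "nxt u v \<noteq> x"
    proof
      assume "nxt u v = x"
      then have ux: "(u, x) \<in> E" using e by simp
      have "nxt x u = u" using edge_orientation[OF ux, of u] uvS S by (auto simp: subtree_def)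
      then show False using edge_orientation[OF ux, of v] \<open>nxt u v = x\<close> uvS uv S
        by (auto simp: subtree_def)
    qed
    then have "nxt x u = nxt x (nxt u v)" using nxt_eq_if_edge[OF e x] uvS by auto
    then show ?thesis using S' uvS \<open>nxt u v \<noteq> x\<close> by (auto simp: branch_def)
  qed
  then show ?thesis using S by (auto simp: subtree_def branch_def)
qed

text \<open>Walking on from \<open>s'\<close> to \<open>x\<close> never reverses an edge, so by
  \<open>edge_orientation\<close> each vertex met points back along the walk towards
  \<open>t\<close>; the last edge before \<open>x\<close> gives the common first step.\<close>

lemma same_branch_if_pointing_away:
  assumes "(s, s') \<in> E" "x \<in> V" "t \<in> V" "s \<noteq> x" "nxt s x = s'" "s' \<noteq> t" "nxt s' t = s"
  shows "x \<noteq> t \<and> nxt x s = nxt x t"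
  using assms
proof (induction "dist s' x" arbitrary: s s' rule: less_induct)
  case less
  have V: "s \<in> V" "s' \<in> V" using less.prems(1) E_subset by auto
  show ?case
  proof (cases "s' = x")
    case True
    then show ?thesis
      using edge_orientation[OF less.prems(1), of s] less.prems V by auto
  next
    case False
    define s'' where "s'' = nxt s' x"
    have e: "(s', s'') \<in> E" using nxt_edge[of s' x] False less.prems V by (simp add: s''_def)
    have "s'' \<noteq> s"
      using edge_orientation[OF less.prems(1), of x] less.prems False by (auto simp: s''_def)
    then have "s'' \<noteq> t \<and> nxt s'' t = s'"
      using edge_orientation[OF e, of t] less.prems by auto
    moreover have "dist s'' x < dist s' x"
      using dist_nxt[of s' x] V less.prems False by (simp add: s''_def)
    ultimately have "x \<noteq> t \<and> nxt x s' = nxt x t"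
      using less.hyps[OF _ e less.prems(2,3) False s''_def[symmetric]] by blast
    then show ?thesis using nxt_eq_if_edge[OF less.prems(1), of x] less.prems False by auto
  qed
qed

text \<open>Each step from \<open>s\<close> towards \<open>x\<close> also approaches
  \<open>t\<close>, since otherwise \<open>s\<close> and \<open>t\<close> would share a branch at
  \<open>x\<close>. Thus \<open>x\<close> lies on the path from \<open>s\<close> to
  \<open>t\<close>.\<close>

lemma dist_le_if_separated:
  assumes "x \<in> V" "s \<in> V" "t \<in> V" and "x \<noteq> s \<Longrightarrow> x \<noteq> t \<Longrightarrow> nxt x s \<noteq> nxt x t"
  shows "dist x t \<le> dist s t"
  using assms
proof (induction "dist s x" arbitrary: s rule: less_induct)
  case less
  show ?case
  proof (cases "s = x \<or> t = x")
    case True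
    then show ?thesis using dist_self less.prems by auto
  next
    case False
    define s' where "s' = nxt s x"
    have e: "(s, s') \<in> E" using nxt_edge[of s x] False less.prems by (simp add: s'_def)
    have s': "s' \<in> V" using e E_subset by blast
    have neq: "nxt x s \<noteq> nxt x t" using less.prems False by blast
    have "s \<noteq> t \<and> nxt s t = s'"
      using same_branch_if_pointing_away[OF e less.prems(1,3)] edge_orientation[OF e less.prems(3)]
        False neq by (auto simp: s'_def)
    then have d: "dist s t = Suc (dist s' t)" using dist_nxt[of s t] less.prems by simp
    show ?thesis
    proof (cases "s' = x")
      case True
      then show ?thesis using d by simp
    next
      case s'x: False
      have "nxt x s = nxt x s'" using nxt_eq_if_edge[OF e less.prems(1)] False s'x by auto
      moreover have "dist s' x < dist s x"
        using dist_nxt[of s x] less.prems False by (simp add: s'_def)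
      ultimately have "dist x t \<le> dist s' t" using less.hyps[of s'] less.prems neq s' by auto
      then show ?thesis using d by simp
    qed
  qed
qed

text \<open>The edges of the path point forward to \<open>t\<close> up to one position and backward
  after it. This turning point is \<open>\<pi> t\<close>, hence the position of the path vertex
  closest to \<open>t\<close>.\<close>

lemma path_with_projection:
  assumes S: "subtree S" and u: "u \<in> S" and v: "v \<in> S"
  obtains p :: "nat \<Rightarrow> 'v" and m :: nat and \<pi> :: "'v \<Rightarrow> nat" where
    "p 0 = u" "p m = v" "\<forall>i\<le>m. p i \<in> S" "\<forall>i<m. (p i, p (Suc i)) \<in> E"
    "\<forall>t\<in>V. \<pi> t \<le> m"
    "\<forall>t\<in>V. \<forall>i\<le>m. i < \<pi> t \<longleftrightarrow> i < m \<and> p i \<noteq> t \<and> nxt (p i) t = p (Suc i)"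
    "\<forall>t\<in>V. \<forall>i\<le>m. \<pi> t < i \<longleftrightarrow> 0 < i \<and> p i \<noteq> t \<and> nxt (p i) t = p (i - 1)"
    "\<forall>t\<in>V. \<forall>i\<le>m. real (dist (p i) t) = \<bar>real (\<pi> t) - real i\<bar> + real (dist (p (\<pi> t)) t)"
proof -
  \<comment> \<open>The iteration is meaningful only up to \<open>m\<close>, since
    \<open>nxt v v\<close> is arbitrary.\<close>
  define p where "p i = ((\<lambda>y. nxt y v) ^^ i) u" for i
  define m where "m = dist u v"
  have SV: "S \<subseteq> V" using S by (simp add: subtree_def)
  have p_Suc: "p (Suc i) = nxt (p i) v" for i by (simp add: p_def)
  have p: "p i \<in> S \<and> dist (p i) v = m - i" if "i \<le> m" for i
    using that
  proof (induction i)
    case 0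
    then show ?case using u by (simp add: p_def m_def)
  next
    case (Suc i)
    then have IH: "p i \<in> S" "dist (p i) v = m - i" by auto
    then have "p i \<noteq> v" using Suc.prems dist_self v SV by force
    then have "dist (p i) v = Suc (dist (p (Suc i)) v)" "p (Suc i) \<in> S"
      using IH S v dist_nxt[of "p i" v] SV by (auto simp: p_Suc subtree_def)
    then show ?case using IH by simp
  qed
  have pV: "p i \<in> V" if "i \<le> m" for i using p[OF that] SV by blast
  have p_m: "p m = v" using p[of m] dist_eq_0D[of "p m" v] SV v by auto
  have edge: "(p i, p (Suc i)) \<in> E" if "i < m" for i
  proof -
    have "p i \<noteq> v" using p[of i] that dist_self v SV by force
    then show ?thesis using nxt_edge[of "p i" v] pV[of i] that v SV by (auto simp: p_Suc)
  qed
  define Q where "Q t i \<longleftrightarrow> i < m \<and> p i \<noteq> t \<and> nxt (p i) t = p (Suc i)" for t i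
  define \<pi> where "\<pi> t = (LEAST i. \<not> Q t i)" for t
  have not_Q: "\<not> Q t (\<pi> t)" for t
    unfolding \<pi>_def by (rule LeastI[of _ m]) (simp add: Q_def)
  have le: "\<pi> t \<le> m" for t
    unfolding \<pi>_def by (rule Least_le) (simp add: Q_def)
  have backward: "\<not> Q t i \<longleftrightarrow> p (Suc i) \<noteq> t \<and> nxt (p (Suc i)) t = p i" if "t \<in> V" "i < m" for t i
    using edge_orientation[OF edge[OF that(2)] that(1)] that(2) by (auto simp: Q_def)
  \<comment> \<open>A backward edge followed by a forward one would make both \<open>p i\<close> and
    \<open>p (Suc (Suc i))\<close> the step from \<open>p (Suc i)\<close> towards \<open>t\<close>,
    yet their distances to \<open>v\<close> differ.\<close>
  have down: "Q t i" if "t \<in> V" "Q t (Suc i)" for t i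
  proof (rule ccontr)
    assume "\<not> Q t i"
    moreover have "Suc i < m" using that(2) by (simp add: Q_def)
    ultimately have "p (Suc (Suc i)) = p i" using that backward[of t i] by (auto simp: Q_def)
    then show False using p[of i] p[of "Suc (Suc i)"] \<open>Suc i < m\<close> by auto
  qed
  have Q_iff: "Q t i \<longleftrightarrow> i < \<pi> t" if t: "t \<in> V" for t i
  proof
    assume "i < \<pi> t"
    then show "Q t i" using not_less_Least unfolding \<pi>_def by blast
  next
    assume Qi: "Q t i"
    have "Q t (i - j)" for j
    proof (induction j)
      case (Suc j)
      then show ?case using down[OF t, of "i - Suc j"] by (cases "j < i") (auto simp: Suc_diff_Suc)
    qed (use Qi in simp)
    from this[of "i - \<pi> t"] show "i < \<pi> t" using not_Q[of t] by (cases "\<pi> t \<le> i") auto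
  qed
  have backward_iff: "\<pi> t < i \<longleftrightarrow> 0 < i \<and> p i \<noteq> t \<and> nxt (p i) t = p (i - 1)"
    if "t \<in> V" "i \<le> m" for t i
    using that backward[of t "i - 1"] Q_iff[of t "i - 1"] by (cases i) auto
  have left: "dist (p (\<pi> t - j)) t = j + dist (p (\<pi> t)) t" if "t \<in> V" "j \<le> \<pi> t" for t j
    using that(2)
  proof (induction j)
    case (Suc j)
    then have "Q t (\<pi> t - Suc j)" using Q_iff[OF that(1)] by simp
    then show ?case using Suc dist_nxt[of "p (\<pi> t - Suc j)" t] pV[of "\<pi> t - Suc j"] le[of t] that(1)
      by (simp add: Q_def Suc_diff_Suc)
  qed simp
  have right: "dist (p (\<pi> t + j)) t = j + dist (p (\<pi> t)) t" if "t \<in> V" "\<pi> t + j \<le> m" for t j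
    using that(2)
  proof (induction j)
    case (Suc j)
    then show ?case
      using backward_iff[OF that(1), of "\<pi> t + Suc j"] dist_nxt[of "p (\<pi> t + Suc j)" t]
        pV[of "\<pi> t + Suc j"] that(1) by simp
  qed simp
  have "real (dist (p i) t) = \<bar>real (\<pi> t) - real i\<bar> + real (dist (p (\<pi> t)) t)"
    if "t \<in> V" "i \<le> m" for t i
  proof (cases "i \<le> \<pi> t")
    case True
    then show ?thesis using left[OF that(1), of "\<pi> t - i"] by (simp add: of_nat_diff)
  next
    case False
    then show ?thesis using right[OF that(1), of "i - \<pi> t"] that(2) by (simp add: of_nat_diff)
  qed
  moreover have "i < \<pi> t \<longleftrightarrow> i < m \<and> p i \<noteq> t \<and> nxt (p i) t = p (Suc i)" if "t \<in> V" for t i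
    unfolding Q_iff[OF that, symmetric] Q_def ..
  moreover have "p 0 = u" by (simp add: p_def)
  ultimately show ?thesis
    using p p_m edge le backward_iff by (intro that[of p m \<pi>] allI ballI impI) blast+
qed

end

section \<open>Induction on the width of a path decomposition\<close>

text \<open>Consecutive chain vertices share a bag and each vertex occupies an interval of bags, so
  the chain cannot jump over bag \<open>l\<close>.\<close>

lemma bag_meets_chain:
  assumes cover: "\<And>c. c < m \<Longrightarrow> \<exists>B\<in>set Bs. p c \<in> B \<and> p (Suc c) \<in> B"
    and interval: "\<And>c i j l. c \<le> m \<Longrightarrow> i \<le> j \<Longrightarrow> j \<le> l \<Longrightarrow> l < length Bs \<Longrightarrow> p c \<in> Bs ! i \<Longrightarrow>
        p c \<in> Bs ! l \<Longrightarrow> p c \<in> Bs ! j"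
    and first: "p 0 \<in> Bs ! i" and last: "p m \<in> Bs ! j"
    and ord: "i \<le> l" "l \<le> j" "j < length Bs"
  shows "\<exists>c\<le>m. p c \<in> Bs ! l"
proof (rule ccontr)
  assume neg: "\<not> ?thesis"
  have "\<forall>b<length Bs. p c \<in> Bs ! b \<longrightarrow> b < l" if "c \<le> m" for c
    using that
  proof (induction c)
    case 0
    then show ?case using interval[of 0 i l] first ord neg by (meson not_less)
  next
    case (Suc c)
    then obtain b where b: "b < length Bs" "p c \<in> Bs ! b" "p (Suc c) \<in> Bs ! b"
      using cover[of c] by (auto simp: in_set_conv_nth)
    then have "b \<le> l" using Suc by fastforce
    then show ?case using interval[of "Suc c" b l] b Suc.prems neg by (meson not_less)
  qed
  from this[of m] show False using last ord by force
qed

context tree_navigation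
begin

text \<open>Width is measured on \<open>B \<inter> S\<close>, so that one decomposition of the whole
  tree serves every subtree of the recursion.\<close>

theorem solvable_subtree:
  assumes bags: "\<Union> (set Bs) = V"
    and cover: "\<And>u v. (u, v) \<in> E \<Longrightarrow> \<exists>B\<in>set Bs. u \<in> B \<and> v \<in> B"
    and interval: "\<And>v i j l. v \<in> V \<Longrightarrow> i \<le> j \<Longrightarrow> j \<le> l \<Longrightarrow> l < length Bs \<Longrightarrow> v \<in> Bs ! i \<Longrightarrow>
        v \<in> Bs ! l \<Longrightarrow> v \<in> Bs ! j"
    and "subtree S" "s \<in> S" "\<And>B. B \<in> set Bs \<Longrightarrow> card (B \<inter> S) \<le> Suc k"
  shows "solvable V reply S (\<lambda>t. 6 * real k * log 2 (real (dist s t) + 2))"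
  using assms(4-6)
proof (induction k arbitrary: S s)
  case 0
  \<comment> \<open>A bag covering an edge inside \<open>S\<close> would contain two vertices of
    \<open>S\<close>. So \<open>s\<close> can be announced without any query.\<close>
  have "S \<subseteq> {s}"
  proof
    fix t assume t: "t \<in> S"
    show "t \<in> {s}"
    proof (rule ccontr)
      assume "t \<notin> {s}"
      with t 0 have e: "(s, nxt s t) \<in> E" and S: "nxt s t \<in> S"
        using nxt_edge by (auto simp: subtree_def)
      then obtain B where B: "B \<in> set Bs" "s \<in> B" "nxt s t \<in> B" using cover by blast
      have "finite (B \<inter> S)" using 0(1) finite_V by (auto simp: subtree_def intro: finite_subset)
      then have "card {s, nxt s t} \<le> card (B \<inter> S)" using B S 0(2) by (intro card_mono) auto
      then show False using 0(3)[OF B(1)] edge_neq[OF e] by simp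
    qed
  qed
  then show ?case by (rule solvable_singleton) simp
next
  case (Suc k)
  note S = Suc.prems(1) and s = Suc.prems(2) and width = Suc.prems(3)
  have SV: "S \<subseteq> V" using S by (simp add: subtree_def)
  then have finS: "finite S" using finite_V finite_subset by blast
  let ?I = "{i. i < length Bs \<and> Bs ! i \<inter> S \<noteq> {}}"
  have "s \<in> \<Union> (set Bs)" using s SV bags by blast
  then obtain i where "i < length Bs" "s \<in> Bs ! i" by (auto simp: in_set_conv_nth)
  then have I: "finite ?I" "?I \<noteq> {}" using s by auto
  from Min_in[OF I] obtain u where u: "u \<in> Bs ! Min ?I" "u \<in> S" by blast
  from Max_in[OF I] obtain v where v: "v \<in> Bs ! Max ?I" "v \<in> S" "Max ?I < length Bs" by blast
  obtain p m \<pi> where p: "p 0 = u" "p m = v" "\<forall>i\<le>m. p i \<in> S" "\<forall>i<m. (p i, p (Suc i)) \<in> E"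
    and "\<forall>t\<in>V. \<pi> t \<le> m"
    and "\<forall>t\<in>V. \<forall>i\<le>m. i < \<pi> t \<longleftrightarrow> i < m \<and> p i \<noteq> t \<and> nxt (p i) t = p (Suc i)"
    and "\<forall>t\<in>V. \<forall>i\<le>m. \<pi> t < i \<longleftrightarrow> 0 < i \<and> p i \<noteq> t \<and> nxt (p i) t = p (i - 1)"
    and "\<forall>t\<in>V. \<forall>i\<le>m.
        real (dist (p i) t) = \<bar>real (\<pi> t) - real i\<bar> + real (dist (p (\<pi> t)) t)"
    by (rule path_with_projection[OF S u(2) v(2)])
  note p = p(1,2) p(3,4)[rule_format]
    and pos_le = this(5)[rule_format] and right = this(6)[rule_format]
    and left = this(7)[rule_format] and dist_p = this(8)[rule_format]
  have pV: "p i \<in> V" if "i \<le> m" for i using p(3)[OF that] SV by blast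
  have pos_p: "\<pi> (p j) = j" if "j \<le> m" for j
    using dist_p[OF pV[OF that] that] dist_self[OF pV[OF that]] by simp
  have meets: "\<exists>c\<le>m. p c \<in> B" if B: "B \<in> set Bs" "B \<inter> S \<noteq> {}" for B
  proof -
    obtain l where l: "l < length Bs" "B = Bs ! l" using B(1) by (auto simp: in_set_conv_nth)
    then have "l \<in> ?I" using B(2) by simp
    then have ord: "Min ?I \<le> l" "l \<le> Max ?I" using I by auto
    show ?thesis unfolding l(2)
    proof (rule bag_meets_chain[of m Bs p "Min ?I" "Max ?I"])
      show "\<exists>B\<in>set Bs. p c \<in> B \<and> p (Suc c) \<in> B" if "c < m" for c using cover p(4)[OF that] .
      show "p c \<in> Bs ! j" if "c \<le> m" "i \<le> j" "j \<le> l" "l < length Bs" "p c \<in> Bs ! i" "p c \<in> Bs ! l"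
        for c i j l using interval[OF pV] that by blast
    qed (use p u v ord in auto)
  qed
  txt \<open>Every bag that meets \<open>S\<close> loses a vertex of the path when passing to a branch off the path.\<close>
  have branch: "solvable V reply (branch S (p (\<pi> w)) (nxt (p (\<pi> w)) w))
      (\<lambda>t. 6 * real k * log 2 (real (dist z t) + 2))"
    if w: "w \<in> S" "p (\<pi> w) \<noteq> w" and z: "z \<in> branch S (p (\<pi> w)) (nxt (p (\<pi> w)) w)" for w z
  proof (rule Suc.IH)
    let ?x = "p (\<pi> w)"
    let ?C = "branch S ?x (nxt ?x w)"
    have wV: "w \<in> V" and le: "\<pi> w \<le> m" using w SV pos_le by auto
    show "subtree ?C" by (rule subtree_branch[OF S pV[OF le]])
    show "z \<in> ?C" by (rule z)
    \<comment> \<open>At its projection \<open>?x\<close>, the first step towards \<open>w\<close>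
      follows the path in neither direction, whereas the step towards any other path vertex
      does.\<close>
    have off: "p c \<notin> ?C" if c: "c \<le> m" for c
    proof
      assume "p c \<in> ?C"
      then have *: "?x \<noteq> p c" "nxt ?x (p c) = nxt ?x w" by (auto simp: branch_def)
      then have "c \<noteq> \<pi> w" by blast
      then consider "c < \<pi> w" | "\<pi> w < c" by linarith
      then show False
      proof cases
        case 1
        then show False
          using left[OF pV[OF c] le] left[OF wV le] pos_p[OF c] * w by simp
      next
        case 2
        then show False
          using right[OF pV[OF c] le] right[OF wV le] pos_p[OF c] * w by simp
      qed
    qed
    show "card (B \<inter> ?C) \<le> Suc k" if B: "B \<in> set Bs" for B
    proof (cases "B \<inter> S = {}")
      case True
      then have "B \<inter> ?C = {}" by (auto simp: branch_def)
      then show ?thesis by simp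
    next
      case False
      then obtain c where c: "c \<le> m" "p c \<in> B" using meets B by blast
      then have "B \<inter> ?C \<subset> B \<inter> S" using off[OF c(1)] p(3)[OF c(1)] by (auto simp: branch_def)
      then have "card (B \<inter> ?C) < card (B \<inter> S)" using finS by (intro psubset_card_mono) auto
      then show ?thesis using width[OF B] by simp
    qed
  qed
  define a where "a = \<pi> s"
  have sV: "s \<in> V" and a: "a \<le> m" using s SV pos_le by (auto simp: a_def)
  \<comment> \<open>The targets outside the branch of \<open>s\<close> at \<open>p a\<close>; for
    \<open>p a = s\<close> this is all of \<open>S\<close>.\<close>
  define A where "A = {t \<in> S. p a \<noteq> s \<longrightarrow> p a \<noteq> t \<longrightarrow> nxt (p a) t \<noteq> nxt (p a) s}"
  have AS: "A \<subseteq> S" by (auto simp: A_def)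
  have near: "dist (p a) t \<le> dist s t" if "t \<in> A" for t
    using that SV pV[OF a] sV by (intro dist_le_if_separated) (auto simp: A_def)
  let ?f = "\<lambda>t. 6 * real k * log 2 (real (dist s t) + 2)"
  interpret line_search V reply A p m \<pi> "\<lambda>t. ?f t + 1"
  proof
    fix i t t'
    assume "i \<le> m" "t \<in> A" "t' \<in> A" "reply t (p i) = reply t' (p i)"
    then show "(\<pi> t < i \<longleftrightarrow> \<pi> t' < i) \<and> (i < \<pi> t \<longleftrightarrow> i < \<pi> t')"
      using left[of t i] left[of t' i] right[of t i] right[of t' i] AS SV
      by (auto simp: reply_def split: if_splits)
  next
    fix i assume i: "i \<le> m"
    \<comment> \<open>A query at \<open>p i\<close>, possibly a repeated one, reveals the branch; it
      is the unit added to \<open>?f t\<close>.\<close>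
    show "solvable V reply {t \<in> A. \<pi> t = i} (\<lambda>t. ?f t + 1)"
    proof (rule solvable_query[OF pV[OF i]])
      fix \<rho>
      let ?B = "{t \<in> {t \<in> A. \<pi> t = i}. reply t (p i) = \<rho>}"
      show "solvable V reply ?B ?f"
      proof (cases "?B \<subseteq> {p i}")
        case True
        then show ?thesis by (rule solvable_singleton) simp
      next
        case False
        then obtain w where w: "w \<in> A" "\<pi> w = i" "reply w (p i) = \<rho>" "w \<noteq> p i" by blast
        \<comment> \<open>The root of the branch becomes the new prediction. It is nearer to
          \<open>t\<close> than \<open>p i\<close>, the path vertex closest to \<open>t\<close>, and
          \<open>near\<close> compares \<open>p a\<close> with \<open>s\<close>.\<close>
        define q where "q = nxt (p i) w"
        have wS: "w \<in> S" using w AS by blast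
        have q: "q \<in> branch S (p i) (nxt (p i) w)"
          using S p(3)[OF i] wS w(4) nxt_of_edge[of "p i" q] nxt_edge[of "p i" w] edge_neq[of "p i" q] SV
          by (auto simp: branch_def q_def subtree_def)
        have "solvable V reply (branch S (p i) (nxt (p i) w))
            (\<lambda>t. 6 * real k * log 2 (real (dist q t) + 2))"
          using branch[OF wS _ q[folded w(2)]] w by auto
        then show ?thesis
        proof (rule solvable_mono)
          show *: "?B \<subseteq> branch S (p i) (nxt (p i) w)"
            using AS w(3,4) by (auto simp: branch_def reply_def split: if_splits)
          fix t assume t: "t \<in> ?B"
          then have tA: "t \<in> A" "t \<in> V" "\<pi> t = i" using AS SV by auto
          have "p i \<noteq> t" "nxt (p i) t = q" using * t by (auto simp: branch_def q_def)
          then have "dist q t \<le> dist (p i) t" using dist_nxt[OF pV[OF i] tA(2)] by simp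
          also have "\<dots> \<le> dist (p a) t" using dist_p[OF tA(2) a] tA(3) by simp
          also have "\<dots> \<le> dist s t" by (rule near[OF tA(1)])
          finally show "6 * real k * log 2 (real (dist q t) + 2) \<le> ?f t"
            by (intro mult_left_mono) auto
        qed
      qed
    qed
  qed (use pV pos_le AS SV in auto)
  let ?g = "\<lambda>t. ?f t + 1 + (2 * log 2 (real (dist s t) + 2) + 2)"
  have on_A: "solvable V reply A ?g"
  proof (rule solvable_mono[OF search_from[OF a] order_refl])
    fix t assume t: "t \<in> A"
    \<comment> \<open>The offset on the path is part of the distance from \<open>p a\<close> to
      \<open>t\<close>, so the galloping is charged to \<open>dist s t\<close>.\<close>
    then have "\<bar>real (\<pi> t) - real a\<bar> \<le> real (dist (p a) t)" using dist_p[of t a] a AS SV by auto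
    also have "\<dots> \<le> real (dist s t)" using near[OF t] by simp
    finally show "?f t + 1 + (2 * log 2 (\<bar>real (\<pi> t) - real a\<bar> + 1) + 2) \<le> ?g t" by simp
  qed
  have "solvable V reply S (\<lambda>t. ?g t + 1)"
  proof (rule solvable_query[OF pV[OF a]])
    fix \<rho>
    let ?B = "{t \<in> S. reply t (p a) = \<rho>}"
    show "solvable V reply ?B ?g"
    proof (cases "p a \<noteq> s \<and> \<rho> = Toward (nxt (p a) s)")
      case True
      have "solvable V reply (branch S (p a) (nxt (p a) s)) ?f"
        using branch[of s s] s True by (simp add: a_def branch_def)
      then show ?thesis
      proof (rule solvable_mono)
        show "?B \<subseteq> branch S (p a) (nxt (p a) s)"
          using True by (auto simp: branch_def reply_def split: if_splits)
      qed simp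
    next
      case False
      then show ?thesis
        by (intro solvable_mono[OF on_A]) (auto simp: A_def reply_def)
    qed
  qed
  then show ?case
  proof (rule solvable_mono)
    fix t
    \<comment> \<open>Beyond the recursion this level costs twice the logarithm plus 4. The 2 inside
      the logarithm makes it at least 1, so a factor of 6 covers both.\<close>
    have "1 \<le> log 2 (real (dist s t) + 2)" by simp
    then show "?g t + 1 \<le> 6 * real (Suc k) * log 2 (real (dist s t) + 2)"
      by (simp add: algebra_simps)
  qed simp
qed

end

section \<open>Unique paths in simple trees\<close>

locale simple_tree_graph = pair_graph +
  assumes tree: "simple_tree G"
begin

lemma arc_sym: "(u, v) \<in> parcs G \<Longrightarrow> (v, u) \<in> parcs G"
  using pair_sym_arcs by (auto simp: symmetric_def sym_def)

lemma apath_splitE: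
  assumes "apath u p v" "w \<in> set (pawalk_verts u p)"
  obtains q r where "p = q @ r" "apath u q w" "apath w r v"
proof -
  obtain q r where qr: "p = q @ r" "awalk u q w" "awalk w r v"
    using awalk_decomp[OF awalkI_apath[OF assms(1)] assms(2)] by blast
  then have "last (pawalk_verts u q) = w" by auto
  then show ?thesis using that[OF qr(1)] assms(1) unfolding qr(1) apath_append_iff by simp
qed

text \<open>If the second vertex \<open>w\<close> of the first path lies on \<open>q\<close>, the
  part of \<open>q\<close> up to \<open>w\<close> closed by the arc \<open>(w, u)\<close> is a
  cycle, so it has length two and that part is the arc \<open>(u, w)\<close>. Otherwise the first
  path would return to \<open>u\<close>.\<close>

lemma apath_unique: "apath u p v \<Longrightarrow> apath u q v \<Longrightarrow> p = q"
proof (induction p arbitrary: u q)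
  case Nil
  then show ?case using apath_nonempty_ends[of u q v] by (auto simp: apath_simps)
next
  case (Cons e p)
  obtain w where e: "e = (u, w)" using Cons.prems(1) by (cases e) (auto simp: apath_simps)
  have uw: "(u, w) \<in> parcs G" "apath w p v" "u \<notin> set (pawalk_verts w p)"
    using Cons.prems(1) by (auto simp: apath_simps e)
  show ?case
  proof (cases "w \<in> set (pawalk_verts u q)")
    case True
    then obtain q1 q2 where q: "q = q1 @ q2" "apath u q1 w" "apath w q2 v"
      using apath_splitE[OF Cons.prems(2)] by metis
    have "u \<noteq> w" using pair_no_loops[OF uw(1)] by simp
    then have ne: "q1 \<noteq> []" using q(2) by (auto simp: apath_simps)
    have aw: "awalk u (q1 @ [(w, u)]) u"
      using q(2) arc_sym[OF uw(1)] uw(1) by (auto simp: apath_def awalk_simps dest: in_arcsD1)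
    have "cycle (q1 @ [(w, u)])"
      unfolding cycle_def using awalk_verts_append[OF aw] q(2) aw ne
      by (cases q1) (auto simp: apath_def awalk_simps)
    then have "length q1 < 2" using tree ne unfolding simple_tree_def by force
    with ne obtain e' where "q1 = [e']" by (cases q1) auto
    then have "q1 = [(u, w)]" using q(2) by (cases e') (auto simp: apath_simps)
    then show ?thesis using Cons.IH[OF uw(2) q(3)] q(1) e by simp
  next
    case False
    txt \<open>Prepending the arc \<open>(w, u)\<close> to \<open>q\<close> gives a path to be compared with the shorter \<open>p\<close>.\<close>
    then have "apath w ((w, u) # q) v" using Cons.prems(2) arc_sym[OF uw(1)] by (simp add: apath_simps)
    then have "p = (w, u) # q" by (rule Cons.IH[OF uw(2)])
    then show ?thesis using uw(3) hd_in_awalk_verts(2)[OF Cons.prems(2)] by simp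
  qed
qed

lemma tree_path_apath:
  assumes "u \<in> pverts G" "v \<in> pverts G"
  shows "apath u (tree_path G u v) v"
proof -
  have "u \<rightarrow>\<^sup>*\<^bsub>mk_symmetric G\<^esub> v"
    using tree assms by (auto simp: simple_tree_def connected_def)
  then have "u \<rightarrow>\<^sup>*\<^bsub>G\<^esub> v" using reachable_mk_symmetric_eq pair_sym_arcs by blast
  then have "\<exists>!p. apath u p v" using apath_unique by (auto simp: reachable_apath)
  then show ?thesis unfolding tree_path_def by (rule theI')
qed

lemma tree_path_eqI: "apath u p v \<Longrightarrow> tree_path G u v = p"
  using apath_unique tree_path_apath awalk_hd_in_verts awalk_last_in_verts awalkI_apath by metis

definition next_vertex :: "'a \<Rightarrow> 'a \<Rightarrow> 'a" where
  "next_vertex x t = snd (hd (tree_path G x t))"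

lemma tree_path_Cons:
  assumes "x \<in> pverts G" "t \<in> pverts G" "x \<noteq> t"
  shows "tree_path G x t = (x, next_vertex x t) # tree_path G (next_vertex x t) t"
    and "(x, next_vertex x t) \<in> parcs G"
    and "x \<notin> set (pawalk_verts (next_vertex x t) (tree_path G (next_vertex x t) t))"
proof -
  have ap: "apath x (tree_path G x t) t" using tree_path_apath assms by blast
  then obtain e p where p: "tree_path G x t = e # p"
    using assms(3) by (cases "tree_path G x t") (auto simp: apath_simps)
  then have e: "e = (x, next_vertex x t)" using ap by (cases e) (auto simp: apath_simps next_vertex_def)
  then have "tree_path G (next_vertex x t) t = p"
    using ap p by (intro tree_path_eqI) (auto simp: apath_simps)
  then show "tree_path G x t = (x, next_vertex x t) # tree_path G (next_vertex x t) t"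
    and "(x, next_vertex x t) \<in> parcs G"
    and "x \<notin> set (pawalk_verts (next_vertex x t) (tree_path G (next_vertex x t) t))"
    using ap p e by (auto simp: apath_simps)
qed

lemma tree_path_arc: "(x, y) \<in> parcs G \<Longrightarrow> tree_path G x y = [(x, y)]"
  using pair_no_loops[of "(x, y)"] by (intro tree_path_eqI) (auto simp: apath_simps dest: in_arcsD2)

text \<open>The initial part of the path up to \<open>y\<close> is itself the path from
  \<open>x\<close> to \<open>y\<close>, a single arc. This gives the uniqueness behind the
  description operator in \<open>query_reply\<close>.\<close>

lemma next_vertex_eqI:
  assumes "(x, y) \<in> parcs G" "t \<in> pverts G" "y \<in> set (pawalk_verts x (tree_path G x t))"
  shows "next_vertex x t = y"
proof -
  obtain q r where "tree_path G x t = q @ r" "apath x q y"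
    using apath_splitE[OF tree_path_apath assms(3)] assms(1,2) in_arcsD1 by metis
  then show ?thesis using tree_path_eqI[of x q y] tree_path_arc[OF assms(1)]
    by (auto simp: next_vertex_def)
qed

lemma next_vertex_on_path:
  assumes "x \<in> pverts G" "t \<in> pverts G" "x \<noteq> t"
  shows "next_vertex x t \<in> set (pawalk_verts x (tree_path G x t))"
proof -
  have "next_vertex x t \<in> pverts G" using tree_path_Cons(2)[OF assms] by (rule in_arcsD2)
  then have "next_vertex x t \<in> set (pawalk_verts (next_vertex x t) (tree_path G (next_vertex x t) t))"
    using hd_in_awalk_verts(2) tree_path_apath assms(2) by blast
  then show ?thesis by (subst tree_path_Cons(1)[OF assms]) simp
qed

lemma query_reply_eq:
  assumes "x \<in> pverts G" "t \<in> pverts G"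
  shows "query_reply G t x = (if x = t then Here else Toward (next_vertex x t))"
proof (cases "x = t")
  case False
  have "(THE y. (x, y) \<in> parcs G \<and> y \<in> set (pawalk_verts x (tree_path G x t))) = next_vertex x t"
  proof (rule the_equality)
    show "(x, next_vertex x t) \<in> parcs G \<and>
        next_vertex x t \<in> set (pawalk_verts x (tree_path G x t))"
      using next_vertex_on_path[OF assms False] tree_path_Cons(2)[OF assms False] by (rule conjI[rotated])
  qed (use next_vertex_eqI[OF _ assms(2)] in blast)
  then show ?thesis using False by (simp add: query_reply_def)
qed (simp add: query_reply_def)

text \<open>The path to \<open>v\<close> extends the nonempty path to \<open>u\<close> by one arc,
  so both begin alike.\<close>

lemma next_vertex_snoc:
  assumes "(u, v) \<in> parcs G" "x \<in> pverts G" "u \<noteq> x" "v \<noteq> x"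
    and "v \<notin> set (pawalk_verts x (tree_path G x u))"
  shows "next_vertex x u = next_vertex x v"
proof -
  have u: "u \<in> pverts G" using assms(1) in_arcsD1 by blast
  have ap: "apath x (tree_path G x u) u" by (rule tree_path_apath[OF assms(2) u])
  then have l: "last (pawalk_verts x (tree_path G x u)) = u" by (auto simp: apath_def)
  have "apath x (tree_path G x u @ [(u, v)]) v"
    unfolding apath_append_iff l using ap assms pair_no_loops[OF assms(1)]
    by (auto simp: apath_simps dest: in_arcsD2)
  then have "tree_path G x v = tree_path G x u @ [(u, v)]" by (rule tree_path_eqI)
  moreover have "tree_path G x u \<noteq> []" using ap assms(3) by (auto simp: apath_simps)
  ultimately show ?thesis by (simp add: next_vertex_def)
qed

lemma next_vertex_prefix:
  assumes "x \<in> pverts G" "u \<in> pverts G" "v \<noteq> x"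
    and "v \<in> set (pawalk_verts x (tree_path G x u))"
  shows "next_vertex x u = next_vertex x v"
proof -
  obtain q r where q: "tree_path G x u = q @ r" "apath x q v"
    using apath_splitE[OF tree_path_apath assms(4)] assms(1,2) by metis
  then have "q \<noteq> []" using assms(3) by (auto simp: apath_simps)
  then show ?thesis using q tree_path_eqI[OF q(2)] by (simp add: next_vertex_def)
qed

sublocale nav: tree_navigation "pverts G" "parcs G" next_vertex "tree_dist G"
proof
  show "finite (pverts G)" by (rule pair_finite_verts)
  show "parcs G \<subseteq> pverts G \<times> pverts G" by (auto dest: in_arcsD1 in_arcsD2)
  show "tree_dist G x x = 0" if "x \<in> pverts G" for x
    using tree_path_eqI[of x "[]" x] that by (simp add: apath_simps tree_dist_def)
next
  fix x t assume "x \<in> pverts G" "t \<in> pverts G" "x \<noteq> t"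
  note * = tree_path_Cons[OF this]
  show "(x, next_vertex x t) \<in> parcs G" by (rule *(2))
  show "tree_dist G x t = Suc (tree_dist G (next_vertex x t) t)"
    unfolding tree_dist_def by (subst *(1)) simp
next
  fix x y t assume xy: "(x, y) \<in> parcs G" and t: "t \<in> pverts G"
  have V: "x \<in> pverts G" "y \<in> pverts G" using xy in_arcsD1 in_arcsD2 by blast+
  show "(x \<noteq> t \<and> next_vertex x t = y) \<longleftrightarrow> \<not> (y \<noteq> t \<and> next_vertex y t = x)"
  proof
    assume 1: "x \<noteq> t \<and> next_vertex x t = y"
    show "\<not> (y \<noteq> t \<and> next_vertex y t = x)"
    proof
      \<comment> \<open>The path from \<open>y\<close> would pass through \<open>x\<close>, but the
        path from \<open>x\<close> continues with it and never revisits \<open>x\<close>.\<close>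
      assume 2: "y \<noteq> t \<and> next_vertex y t = x"
      then have "x \<in> set (pawalk_verts y (tree_path G y t))"
        using next_vertex_on_path[OF V(2) t] by auto
      then show False using tree_path_Cons(3)[OF V(1) t] 1 by simp
    qed
  next
    assume 2: "\<not> (y \<noteq> t \<and> next_vertex y t = x)"
    have on: "y \<in> set (pawalk_verts x (tree_path G x t))"
    proof (rule ccontr)
      \<comment> \<open>Prepending \<open>y\<close> then yields the path from \<open>y\<close> to
        \<open>t\<close>, whose first step is \<open>x\<close>, against \<open>2\<close>.\<close>
      assume off: "y \<notin> set (pawalk_verts x (tree_path G x t))"
      then have "apath y ((y, x) # tree_path G x t) t"
        using arc_sym[OF xy] tree_path_apath[OF V(1) t] by (simp add: apath_simps)
      then have "tree_path G y t = (y, x) # tree_path G x t" by (rule tree_path_eqI)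
      moreover have "t \<in> set (pawalk_verts x (tree_path G x t))"
      proof -
        have "last (pawalk_verts x (tree_path G x t)) = t"
          using tree_path_apath[OF V(1) t] by (auto simp: apath_def)
        then show ?thesis by (metis awalk_verts_non_Nil last_in_set)
      qed
      ultimately show False using 2 off by (auto simp: next_vertex_def)
    qed
    have "x \<noteq> t"
    proof
      assume "x = t"
      then have "tree_path G x t = []" using tree_path_eqI[of x "[]" x] V by (simp add: apath_simps)
      then show False using on pair_no_loops[OF xy] by simp
    qed
    then show "x \<noteq> t \<and> next_vertex x t = y" using next_vertex_eqI[OF xy t on] by simp
  qed
next
  fix u v x assume "(u, v) \<in> parcs G" "x \<in> pverts G" "u \<noteq> x" "v \<noteq> x"
  then show "next_vertex x u = next_vertex x v"
    using next_vertex_snoc next_vertex_prefix in_arcsD1 by metis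
qed

section \<open>Transfer to the search problem\<close>

text \<open>The two reply functions agree at vertices of the tree. A run that queries only such
  vertices is therefore the same under both.\<close>

lemma solvable_query_reply:
  assumes "solvable (pverts G) nav.reply A f" "A \<subseteq> pverts G"
  shows "solvable (pverts G) (query_reply G) A f"
proof -
  obtain \<sigma> where \<sigma>: "\<forall>t\<in>A. set (queries \<sigma> (nav.reply t)) \<subseteq> pverts G \<and>
      announced \<sigma> (nav.reply t) = t \<and> real (length (queries \<sigma> (nav.reply t))) \<le> f t"
    using assms(1) unfolding solvable_def by blast
  have "set (queries \<tau> (nav.reply t)) \<subseteq> pverts G \<Longrightarrow>
      queries \<tau> (query_reply G t) = queries \<tau> (nav.reply t) \<and>
      announced \<tau> (query_reply G t) = announced \<tau> (nav.reply t)" if "t \<in> pverts G" for \<tau> t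
    by (induction \<tau>) (use that in \<open>auto simp: query_reply_eq nav.reply_def\<close>)
  then show ?thesis using \<sigma> assms(2) unfolding solvable_def by (intro exI[of _ \<sigma>]) force
qed

lemma pathwidth_decomposition:
  obtains Bs where "path_decomposition G Bs" "\<And>B. B \<in> set Bs \<Longrightarrow> card B \<le> Suc (pathwidth G)"
proof -
  \<comment> \<open>The one-bag decomposition shows that the minimum defining
    \<open>pathwidth\<close> is attained.\<close>
  have "path_decomposition G [pverts G]"
    by (auto simp: path_decomposition_def dest: in_arcsD1 in_arcsD2)
  then have "\<exists>w Bs. path_decomposition G Bs \<and> decomposition_width Bs = w" by blast
  from LeastI_ex[OF this]
  obtain Bs where Bs: "path_decomposition G Bs" "decomposition_width Bs = pathwidth G"
    unfolding pathwidth_def by blast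
  have "card B \<le> Suc (pathwidth G)" if "B \<in> set Bs" for B
  proof -
    have "card B \<le> Max (card ` set Bs)" using that by (intro Max_ge) auto
    then show ?thesis using Bs(2) by (simp add: decomposition_width_def)
  qed
  then show ?thesis using that Bs(1) by blast
qed

lemma solvable_tree:
  assumes "s \<in> pverts G"
  shows "solvable (pverts G) (query_reply G) (pverts G)
    (\<lambda>t. 6 * real (pathwidth G) * log 2 (real (tree_dist G s t) + 2))"
proof -
  obtain Bs where Bs: "path_decomposition G Bs" "\<And>B. B \<in> set Bs \<Longrightarrow> card B \<le> Suc (pathwidth G)"
    using pathwidth_decomposition by blast
  show ?thesis
  proof (rule solvable_query_reply[OF nav.solvable_subtree[of Bs]])
    show "\<Union> (set Bs) = pverts G" using Bs(1) by (simp add: path_decomposition_def)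
    show "\<exists>B\<in>set Bs. u \<in> B \<and> v \<in> B" if "(u, v) \<in> parcs G" for u v
      using Bs(1) that unfolding path_decomposition_def by blast
    show "v \<in> Bs ! j" if "v \<in> pverts G" "i \<le> j" "j \<le> l" "l < length Bs" "v \<in> Bs ! i" "v \<in> Bs ! l"
      for v i j l using Bs(1) that unfolding path_decomposition_def by blast
    show "nav.subtree (pverts G)" using nav.nxt_in by (auto simp: nav.subtree_def)
    show "card (B \<inter> pverts G) \<le> Suc (pathwidth G)" if "B \<in> set Bs" for B
    proof -
      have "B \<subseteq> pverts G" using Bs(1) that by (auto simp: path_decomposition_def)
      then show ?thesis using Bs(2)[OF that] by (simp add: Int_absorb2)
    qed
  qed (use assms in auto)
qed

end

theorem theorem2:
  shows "\<exists>alg :: 'v pair_pre_digraph \<Rightarrow> 'v \<Rightarrow> 'v strategy.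
    solves_tree_search alg \<and>
    (\<exists>C :: real. \<forall>(T :: 'v pair_pre_digraph) (k :: nat).
       simple_tree T \<and> pathwidth T = k \<longrightarrow>
       (\<forall>s \<in> pverts T. \<forall>t \<in> pverts T.
          real (length (queries (alg T s) (query_reply T t)))
            \<le> C * real k * log 2 (real (tree_dist T s t) + 2)))"
proof -
  \<comment> \<open>The strategy depends on \<open>T\<close> and \<open>s\<close> alone, so choosing
    one for each pair yields the algorithm, with the constant 6 for all trees.\<close>
  have "\<exists>\<sigma>. simple_tree T \<and> s \<in> pverts T \<longrightarrow> (\<forall>t\<in>pverts T.
      set (queries \<sigma> (query_reply T t)) \<subseteq> pverts T \<and> announced \<sigma> (query_reply T t) = t \<and>
      real (length (queries \<sigma> (query_reply T t)))
        \<le> 6 * real (pathwidth T) * log 2 (real (tree_dist T s t) + 2))"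
    for T :: "'v pair_pre_digraph" and s
  proof (cases "simple_tree T \<and> s \<in> pverts T")
    case True
    then interpret simple_tree_graph T
      by (simp add: simple_tree_graph_def simple_tree_graph_axioms_def simple_tree_def)
    show ?thesis using solvable_tree[of s] True unfolding solvable_def by blast
  qed blast
  then obtain alg :: "'v pair_pre_digraph \<Rightarrow> 'v \<Rightarrow> 'v strategy" where
    alg: "\<And>T s. simple_tree T \<and> s \<in> pverts T \<longrightarrow> (\<forall>t\<in>pverts T.
      set (queries (alg T s) (query_reply T t)) \<subseteq> pverts T \<and>
      announced (alg T s) (query_reply T t) = t \<and>
      real (length (queries (alg T s) (query_reply T t)))
        \<le> 6 * real (pathwidth T) * log 2 (real (tree_dist T s t) + 2))"
    by metis
  show ?thesis
  proof (intro exI[of _ alg] conjI)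
    show "solves_tree_search alg" unfolding solves_tree_search_def using alg by blast
  qed (intro exI[of _ 6], use alg in blast)
qed

end
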